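(* Let $N$ be a positive integer, $p\in(1,N)$, $\Lambda\ge 1$ and $T>0$. Let $H:(0,T)\times\mathbb{R}^N\times\mathbb{R}^N\to\mathbb{R}$ satisfy $$\frac{1}{\Lambda}|P|^p-\Lambda\le H(t,x,P)\le \Lambda|P|^p+\Lambda\qquad\text{for all }(t,x,P)\in(0,T)\times\mathbb{R}^N\times\mathbb{R}^N .$$ Let $u$ be a bounded viscosity solution on $(0,T)\times\mathbb{R}^N$ of $$\partial_t u+H(t,x,\nabla u)=0 .$$ Then for each $\delta\in(0,T)$ we have $u\in C^{\alpha}([\delta,T)\times\mathbb{R}^N)$, where $\alpha\in(0,1)$ and the norm $\|u\|_{C^\alpha([\delta,T)\times\mathbb{R}^N)}$ depend only on $N$, $\delta$, $\Lambda$, $p$ and $\|u\|_{L^\infty((0,T)\times\mathbb{R}^N)}$. (That is, $\alpha$ and an upper bound for the norm can be chosen as functions of these quantities only, with no dependence on any regularity of $H$.)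
   Context: Viscosity solutions are understood in the usual Crandall–Lions sense (in particular they are continuous functions). $C^\alpha$ denotes the space of bounded functions that are Hölder continuous with exponent $\alpha$ jointly in $(t,x)$, with its usual norm. $\nabla$ is the gradient in the $x$ variable. *)

theory Defs
  imports "HOL-Probability.Essential_Supremum"
begin

text \<open>
  \<open>C1_test \<Omega> \<phi> a g\<close>: on the open set \<open>\<Omega>\<close> of space-time, \<open>\<phi>\<close> is continuously differentiable
  with time derivative \<open>a\<close> and spatial gradient \<open>g\<close>.
\<close>

definition C1_test ::
  "(real \<times> (real ^ 'n)) set \<Rightarrow> (real \<times> (real ^ 'n) \<Rightarrow> real) \<Rightarrow> (real \<times> (real ^ 'n) \<Rightarrow> real)
    \<Rightarrow> (real \<times> (real ^ 'n) \<Rightarrow> real ^ 'n) \<Rightarrow> bool" where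
  "C1_test \<Omega> \<phi> a g \<longleftrightarrow> continuous_on \<Omega> a \<and> continuous_on \<Omega> g \<and>
     (\<forall>z\<in>\<Omega>. (\<phi> has_derivative (\<lambda>w. a z * fst w + g z \<bullet> snd w)) (at z))"

definition local_max_at :: "('a::topological_space \<Rightarrow> real) \<Rightarrow> 'a \<Rightarrow> bool" where
  "local_max_at f z \<longleftrightarrow> (\<forall>\<^sub>F w in nhds z. f w \<le> f z)"

definition local_min_at :: "('a::topological_space \<Rightarrow> real) \<Rightarrow> 'a \<Rightarrow> bool" where
  "local_min_at f z \<longleftrightarrow> (\<forall>\<^sub>F w in nhds z. f z \<le> f w)"

text \<open>
  Viscosity solutions of \<open>\<partial>\<^sub>t u + H(t, x, \<nabla>u) = 0\<close> on an open set \<open>\<Omega>\<close>, with \<open>C\<^sup>1\<close> test functions.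
  The Hamiltonian is evaluated pointwise; no continuity of \<open>H\<close> is required.
\<close>

definition viscosity_subsolution ::
  "(real \<times> (real ^ 'n)) set \<Rightarrow> (real \<Rightarrow> real ^ 'n \<Rightarrow> real ^ 'n \<Rightarrow> real)
    \<Rightarrow> (real \<times> (real ^ 'n) \<Rightarrow> real) \<Rightarrow> bool" where
  "viscosity_subsolution \<Omega> H u \<longleftrightarrow> continuous_on \<Omega> u \<and>
     (\<forall>\<phi> a g z. C1_test \<Omega> \<phi> a g \<longrightarrow> z \<in> \<Omega> \<longrightarrow> local_max_at (\<lambda>w. u w - \<phi> w) z
        \<longrightarrow> a z + H (fst z) (snd z) (g z) \<le> 0)"

definition viscosity_supersolution ::
  "(real \<times> (real ^ 'n)) set \<Rightarrow> (real \<Rightarrow> real ^ 'n \<Rightarrow> real ^ 'n \<Rightarrow> real)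
    \<Rightarrow> (real \<times> (real ^ 'n) \<Rightarrow> real) \<Rightarrow> bool" where
  "viscosity_supersolution \<Omega> H u \<longleftrightarrow> continuous_on \<Omega> u \<and>
     (\<forall>\<phi> a g z. C1_test \<Omega> \<phi> a g \<longrightarrow> z \<in> \<Omega> \<longrightarrow> local_min_at (\<lambda>w. u w - \<phi> w) z
        \<longrightarrow> a z + H (fst z) (snd z) (g z) \<ge> 0)"

definition viscosity_solution ::
  "(real \<times> (real ^ 'n)) set \<Rightarrow> (real \<Rightarrow> real ^ 'n \<Rightarrow> real ^ 'n \<Rightarrow> real)
    \<Rightarrow> (real \<times> (real ^ 'n) \<Rightarrow> real) \<Rightarrow> bool" where
  "viscosity_solution \<Omega> H u \<longleftrightarrow> viscosity_subsolution \<Omega> H u \<and> viscosity_supersolution \<Omega> H u"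

text \<open>
  Extended-real valued; the library's \<open>esssup\<close> is \<open>\<infinity>\<close> for non-measurable functions.
\<close>

definition Linf_norm :: "'a::euclidean_space set \<Rightarrow> ('a \<Rightarrow> real) \<Rightarrow> ereal" where
  "Linf_norm \<Omega> u = esssup (lebesgue_on \<Omega>) (\<lambda>z. ereal \<bar>u z\<bar>)"

definition holder_space :: "real \<Rightarrow> 'a::metric_space set \<Rightarrow> ('a \<Rightarrow> real) set" where
  "holder_space \<alpha> S = {u. bounded (u ` S) \<and>
     (\<exists>K. \<forall>z\<in>S. \<forall>w\<in>S. \<bar>u z - u w\<bar> \<le> K * dist z w powr \<alpha>)}"

text \<open>
  The real-valued suprema below are meaningful when \<open>u \<in> holder_space \<alpha> S\<close> and \<open>S\<close> has at least
  two points.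
\<close>

definition holder_norm :: "real \<Rightarrow> 'a::metric_space set \<Rightarrow> ('a \<Rightarrow> real) \<Rightarrow> real" where
  "holder_norm \<alpha> S u = (SUP z\<in>S. \<bar>u z\<bar>) +
     (SUP (z, w)\<in>{(z, w). z \<in> S \<and> w \<in> S \<and> z \<noteq> w}. \<bar>u z - u w\<bar> / dist z w powr \<alpha>)"

end

theory Submission
  imports Defs
begin

text \<open>
  Let \<open>q = p / (p - 1)\<close> and write \<open>F(d, h) = d\<^sup>q h\<^bsup>1-q\<^esup>\<close> for the cost of covering a distance \<open>d\<close> in
  time \<open>h\<close>. Comparison with explicit test functions gives, for \<open>s < t\<close>,
  \<open>u(t, x) \<le> u(s, y) + C F(|x - y|, t - s) + D (t - s)\<close> for all \<open>y\<close>, and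
  \<open>u(t, x) \<ge> u(s, y) + \<kappa> F(|x - y|, t - s) - D (t - s)\<close> for some \<open>y\<close>.

  Going backwards from \<open>(t, x)\<close> through the times \<open>t - h \<mu>\<^sup>k\<close> along nearly optimal points \<open>z\<^sub>k\<close>, set
  \<open>\<Phi>\<^sub>k = u(t, x) - u(t - h \<mu>\<^sup>k, z\<^sub>k)\<close>. The second inequality bounds the cost spent by \<open>\<Phi>\<close>, whereas the
  first bounds \<open>\<Phi>\<^sub>k\<close> by the cost of the total displacement. Since \<open>q > 1\<close>, a displacement achieved
  at time scale \<open>h \<mu>\<^bsup>k+1\<^esup>\<close> is cheap at scale \<open>h \<mu>\<^sup>k\<close>, so for small \<open>\<mu>\<close> a fixed fraction of
  \<open>\<Phi>\<^sub>k\<close> is spent between two consecutive times (a discrete reverse Hoelder inequality), and \<open>\<Phi>\<^sub>k\<close>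
  decays geometrically. Comparing a point near \<open>(t, x)\<close> with \<open>z\<^sub>k\<close> then gives geometric decay of the
  oscillation of \<open>u\<close>.
\<close>

section \<open>The action cost\<close>

text \<open>This is the action of a straight path for the Lagrangian \<open>|v|^q\<close>. In this
  form it is the perspective of a convex power, which makes subadditivity an instance of Jensen's
  inequality.\<close>

definition cost :: "real \<Rightarrow> real \<Rightarrow> real \<Rightarrow> real" where
  "cost q d h = h * (d / h) powr q"

lemma cost_nonneg: "0 \<le> h \<Longrightarrow> 0 \<le> cost q d h"
  by (simp add: cost_def)

lemma cost_eq: "0 < h \<Longrightarrow> 0 \<le> d \<Longrightarrow> cost q d h = d powr q * h powr (1 - q)"
  by (simp add: cost_def powr_divide powr_diff)

lemma cost_mono: "0 \<le> d \<Longrightarrow> d \<le> d' \<Longrightarrow> 0 < h \<Longrightarrow> 0 \<le> q \<Longrightarrow> cost q d h \<le> cost q d' h"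
  by (auto simp: cost_def intro!: mult_left_mono powr_mono2 divide_right_mono)

lemma cost_antimono_time:
  assumes "0 \<le> d" "0 < h" "h \<le> h'" "1 \<le> q"
  shows "cost q d h' \<le> cost q d h"
  using assms by (auto simp: cost_eq intro!: mult_left_mono powr_mono2')

lemma cost_le_time:
  assumes "0 \<le> d" "d \<le> h" "0 < h" "0 \<le> q"
  shows "cost q d h \<le> h"
proof -
  have "(d / h) powr q \<le> 1 powr q"
    using assms by (intro powr_mono2) auto
  then show ?thesis using assms by (simp add: cost_def mult_left_le)
qed

text \<open>Jensen's inequality for the velocities \<open>a / r\<close> and \<open>b / s\<close>
  with weights \<open>r / (r + s)\<close> and \<open>s / (r + s)\<close>. If a distance vanishes,
  monotonicity in time suffices.\<close>

lemma cost_add: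
  assumes "0 \<le> a" "0 \<le> b" "0 < r" "0 < s" "1 \<le> q"
  shows "cost q (a + b) (r + s) \<le> cost q a r + cost q b s"
proof -
  consider "a = 0" | "b = 0" | "0 < a" "0 < b" using assms by linarith
  then show ?thesis
  proof cases
    case 1
    then show ?thesis
      using cost_antimono_time[of b s "r + s" q] cost_nonneg[of r q a] assms by simp
  next
    case 2
    then show ?thesis
      using cost_antimono_time[of a r "r + s" q] cost_nonneg[of s q b] assms by simp
  next
    case 3
    define t where "t = s / (r + s)"
    have t: "0 \<le> t" "t \<le> 1" "1 - t = r / (r + s)"
      using assms by (auto simp: t_def field_simps)
    have "((1 - t) *\<^sub>R (a / r) + t *\<^sub>R (b / s)) powr q
        \<le> (1 - t) * (a / r) powr q + t * (b / s) powr q"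
      using convex_onD[OF powr_convex[OF assms(5)] t(1,2), of "a / r" "b / s"] 3 assms by simp
    moreover have "(1 - t) *\<^sub>R (a / r) + t *\<^sub>R (b / s) = (a + b) / (r + s)"
      unfolding t(3) using assms by (simp add: t_def add_divide_distrib)
    ultimately have "((a + b) / (r + s)) powr q
        \<le> (r * (a / r) powr q + s * (b / s) powr q) / (r + s)"
      unfolding t(3) by (simp add: t_def add_divide_distrib)
    then show ?thesis using assms by (simp add: cost_def field_simps)
  qed
qed

text \<open>Subadditivity over the doubled time \<open>h + h\<close>; returning to time
  \<open>h\<close> costs the factor \<open>2 powr (q - 1)\<close>, rounded up to
  \<open>2 powr q\<close>.\<close>

lemma cost_double:
  assumes "0 \<le> a" "0 \<le> b" "0 < h" "1 \<le> q"
  shows "cost q (a + b) h \<le> 2 powr q * (cost q a h + cost q b h)"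
proof -
  have "cost q (a + b) (h + h) \<le> cost q a h + cost q b h"
    using cost_add[of a b h h q] assms by simp
  moreover have "cost q (a + b) h = 2 powr (q - 1) * cost q (a + b) (h + h)"
  proof -
    have "(h + h) powr (1 - q) = 2 powr (1 - q) * h powr (1 - q)"
      using powr_mult[of 2 h "1 - q"] assms by simp
    moreover have "2 powr (q - 1) * 2 powr (1 - q) = (1::real)"
      by (simp add: powr_add[symmetric])
    ultimately show ?thesis using assms by (simp add: cost_eq)
  qed
  moreover have "2 powr (q - 1) \<le> (2::real) powr q" by (rule powr_mono) auto
  ultimately show ?thesis
    using cost_nonneg[of "h + h" q "a + b"] assms by (simp add: mult_mono)
qed

lemma cost_half:
  assumes "0 \<le> d" "0 < h" "1 \<le> q"
  shows "cost q d (h / 2) \<le> 2 powr q * cost q d h"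
proof -
  have "(h / 2) powr (1 - q) = 2 powr (q - 1) * h powr (1 - q)"
    using powr_divide[of h 2 "1 - q"] assms
    by (simp add: powr_diff ac_simps)
  moreover have "2 powr (q - 1) \<le> (2::real) powr q" by (rule powr_mono) auto
  ultimately have "d powr q * (h / 2) powr (1 - q) \<le> d powr q * (2 powr q * h powr (1 - q))"
    by (auto intro!: mult_left_mono mult_right_mono)
  then show ?thesis using assms by (simp add: cost_eq ac_simps)
qed

text \<open>For \<open>q > 1\<close> the factor \<open>\<mu> powr (q - 1)\<close> tends to 0 with
  \<open>\<mu>\<close>; this is the gain behind the energy decay.\<close>

lemma cost_shrink:
  assumes "0 \<le> d" "0 < h" "0 < \<mu>"
  shows "cost q d h = \<mu> powr (q - 1) * cost q d (\<mu> * h)"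
proof -
  have "\<mu> powr (q - 1) * \<mu> powr (1 - q) = 1"
    using assms by (simp add: powr_add[symmetric])
  then show ?thesis using assms by (simp add: cost_eq powr_mult)
qed

section \<open>Hoelder continuity from action bounds\<close>

text \<open>This isolates what the regularity argument takes from the equation. Any metric space
  will do, since only the triangle inequality enters; \<open>D\<close> absorbs the additive
  constants of the growth bounds.\<close>

locale action_bounds =
  fixes u :: "real \<times> 'a::metric_space \<Rightarrow> real" and T q C \<kappa> D M :: real
  assumes q: "1 < q" and C: "1 \<le> C" and \<kappa>: "0 < \<kappa>" "\<kappa> \<le> 1" and D: "0 \<le> D"
    and bdd: "\<And>t x. 0 < t \<Longrightarrow> t < T \<Longrightarrow> \<bar>u (t, x)\<bar> \<le> M"
    and upper: "\<And>s t x y. 0 < s \<Longrightarrow> s < t \<Longrightarrow> t < T \<Longrightarrow>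
        u (t, x) \<le> u (s, y) + C * cost q (dist x y) (t - s) + D * (t - s)"
    and lower: "\<And>s t x. 0 < s \<Longrightarrow> s < t \<Longrightarrow> t < T \<Longrightarrow>
        \<exists>y. u (s, y) + \<kappa> * cost q (dist x y) (t - s) - D * (t - s) \<le> u (t, x)"
begin

text \<open>
  The induction hypothesis is applied to a nearly optimal point one time scale further back; it
  inherits the energy hypothesis on \<open>z\<close> by subadditivity of the cost, so no trajectory has to be
  constructed.
\<close>

lemma energy_decay:
  fixes A \<mu> \<theta> K :: real
  assumes A: "A = C * 2 powr q / \<kappa>"
    and \<mu>: "0 < \<mu>" "\<mu> \<le> 1/2" "A * \<mu> powr (q - 1) \<le> 1/2"
    and \<theta>: "\<theta> = (A - 3/4) / (A - 1/2)"
    and K: "K \<ge> 2 * M" "K \<ge> 4 * (A + 2) * D * h"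
    and h: "0 < h" "h < t" "t < T"
    and E: "\<kappa> * cost q (dist x z) (h * \<mu> ^ k) - D * (h * \<mu> ^ k) \<le> u (t, x) - u (t - h * \<mu> ^ k, z)"
  shows "u (t, x) - u (t - h * \<mu> ^ k, z) \<le> K * \<theta> ^ k"
proof -
  have "2 powr 1 \<le> 2 powr q" using q by (intro powr_mono) auto
  then have "2 * 1 \<le> 2 powr q * C" using C by (intro mult_mono) auto
  moreover have "C * 2 powr q / 1 \<le> C * 2 powr q / \<kappa>"
    using \<kappa> C by (intro divide_left_mono) auto
  ultimately have A2: "2 \<le> A" by (simp add: A mult.commute)
  \<comment> \<open>With \<open>\<mu> \<le> \<theta>\<close>, the errors \<open>D * R\<close>, of
    order \<open>\<mu> ^ k\<close>, fit into a bound of order \<open>\<theta> ^ k\<close>.\<close>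
  have "1/2 \<le> \<theta>" using A2 by (simp add: \<theta> field_simps)
  then have \<mu>\<theta>: "\<mu> \<le> \<theta>" using \<mu> by linarith
  show ?thesis using E
  proof (induction k arbitrary: z)
    case 0
    then show ?case
      using K bdd[of t x] bdd[of "t - h" z] h by simp
  next
    case (Suc k)
    define r R where "r = h * \<mu> ^ Suc k" and "R = h * \<mu> ^ k"
    have rR: "0 < r" "r = \<mu> * R" "0 < R" using \<mu> h by (auto simp: r_def R_def)
    then have "r \<le> R / 2" using \<mu> by simp
    then have rR': "r < R" using rR by simp
    have "\<mu> ^ k \<le> 1" using \<mu> by (simp add: power_le_one)
    then have Rh: "R \<le> h" using h by (simp add: R_def)
    obtain y where y: "u (t - R, y) + \<kappa> * cost q (dist z y) (R - r) - D * (R - r) \<le> u (t - r, z)"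
    proof -
      have "0 < t - R" "t - R < t - r" "t - r < T" using rR(1) rR' Rh h by linarith+
      then show ?thesis using lower[of "t - R" "t - r" z] that by auto
    qed
    define b d where "b = dist x z" and "d = dist z y"
    have bd: "0 \<le> b" "0 \<le> d" "dist x y \<le> b + d"
      by (auto simp: b_def d_def dist_triangle)
    define \<Phi> \<Psi> where "\<Phi> = u (t, x) - u (t - R, y)" and "\<Psi> = u (t, x) - u (t - r, z)"
    have e1: "\<kappa> * cost q b r - D * r \<le> \<Psi>"
      using Suc.prems by (simp add: r_def b_def \<Psi>_def)
    have e2: "\<kappa> * cost q d (R - r) - D * (R - r) \<le> \<Phi> - \<Psi>"
      using y by (simp add: d_def \<Phi>_def \<Psi>_def)
    have "cost q (dist x y) R \<le> cost q (b + d) (r + (R - r))"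
      using bd rR q by (auto intro!: cost_mono)
    also have "\<dots> \<le> cost q b r + cost q d (R - r)"
      using bd rR rR' q by (intro cost_add) auto
    finally have "\<kappa> * cost q (dist x y) R \<le> \<kappa> * (cost q b r + cost q d (R - r))"
      using \<kappa> by simp
    then have "\<kappa> * cost q (dist x y) R - D * R \<le> \<Phi>"
      using e1 e2 by (simp add: algebra_simps)
    then have IH: "\<Phi> \<le> K * \<theta> ^ k"
      using Suc.IH[of y] by (simp add: \<Phi>_def R_def)
    \<comment> \<open>The displacement \<open>b\<close> took time \<open>r = \<mu> * R\<close>.
      Spread over time \<open>R\<close>, its cost shrinks enough to beat the factor
      \<open>A\<close>.\<close>
    have f1: "A * cost q b R * \<kappa> \<le> (\<Psi> + D * r) / 2"
    proof -
      have "A * cost q b R * \<kappa> = (A * \<mu> powr (q - 1)) * (\<kappa> * cost q b r)"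
        using cost_shrink[of b R \<mu> q] bd rR \<mu> by simp
      also have "\<dots> \<le> 1/2 * (\<kappa> * cost q b r)"
        using \<mu> \<kappa> cost_nonneg[of r q b] rR by (intro mult_right_mono) auto
      finally show ?thesis using e1 by simp
    qed
    \<comment> \<open>The displacement \<open>d\<close> is paid for by the increment
      \<open>\<Phi> - \<Psi>\<close>.\<close>
    have f2: "A * cost q d R * \<kappa> \<le> A * (\<Phi> - \<Psi> + D * R)"
    proof -
      have "\<kappa> * cost q d R \<le> \<kappa> * cost q d (R - r)"
        using \<kappa> bd rR rR' q by (intro mult_left_mono cost_antimono_time) auto
      moreover have "D * (R - r) \<le> D * R" using D rR by (intro mult_left_mono) auto
      ultimately have "\<kappa> * cost q d R \<le> \<Phi> - \<Psi> + D * R" using e2 by linarith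
      then have "A * (\<kappa> * cost q d R) \<le> A * (\<Phi> - \<Psi> + D * R)" using A2 by simp
      then show ?thesis by (simp add: ac_simps)
    qed
    have "\<Phi> \<le> C * cost q (dist x y) R + D * R"
      using upper[of "t - R" t x y] rR Rh h by (simp add: \<Phi>_def)
    also have "C * cost q (dist x y) R \<le> C * (2 powr q * (cost q b R + cost q d R))"
      using cost_double[of b d R q] cost_mono[of "dist x y" "b + d" R q] bd rR q C
      by (intro mult_left_mono) auto
    also have "\<dots> = A * cost q b R * \<kappa> + A * cost q d R * \<kappa>"
      using \<kappa> by (simp add: A algebra_simps)
    finally have "\<Phi> \<le> (\<Psi> + D * r) / 2 + A * (\<Phi> - \<Psi> + D * R) + D * R"
      using f1 f2 by linarith
    moreover have "D * r \<le> D * R" using D rR' by (intro mult_left_mono) auto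
    moreover have "0 \<le> D * R" using D rR by simp
    moreover have "(A - 1/2) * \<Psi> = A * \<Psi> - \<Psi> / 2" "(A - 1) * \<Phi> = A * \<Phi> - \<Phi>"
        "(A + 2) * (D * R) = A * (D * R) + 2 * (D * R)"
        "A * (\<Phi> - \<Psi> + D * R) = A * \<Phi> - A * \<Psi> + A * (D * R)"
      by (simp_all add: algebra_simps)
    \<comment> \<open>Solving for \<open>\<Psi>\<close> leaves the ratio
      \<open>(A - 1) / (A - 1/2)\<close>. The error term below adds at most \<open>1/4\<close> to
      the numerator, which explains the value of \<open>\<theta>\<close>.\<close>
    ultimately have "(A - 1/2) * \<Psi> \<le> (A - 1) * \<Phi> + (A + 2) * (D * R)"
      by argo
    also have "(A - 1) * \<Phi> \<le> (A - 1) * (K * \<theta> ^ k)"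
      using IH A2 by (intro mult_left_mono) auto
    also have "(A + 2) * (D * R) \<le> 1/4 * (K * \<theta> ^ k)"
    proof -
      have "(4 * (A + 2) * D * h) * \<mu> ^ k \<le> K * \<theta> ^ k"
      proof (intro mult_mono power_mono)
        have "0 \<le> 4 * (A + 2) * D * h" using A2 D h by simp
        then show "0 \<le> K" using K(2) by linarith
      qed (use K \<mu> \<mu>\<theta> in auto)
      then show ?thesis by (simp add: R_def algebra_simps)
    qed
    finally have "(A - 1/2) * \<Psi> \<le> (A - 3/4) * (K * \<theta> ^ k)"
      by (simp add: algebra_simps)
    then have "\<Psi> \<le> (A - 3/4) * (K * \<theta> ^ k) / (A - 1/2)"
      using A2 by (simp add: pos_le_divide_eq mult.commute)
    also have "\<dots> = K * \<theta> ^ Suc k" by (simp add: \<theta>)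
    finally show ?case by (simp add: \<Psi>_def r_def)
  qed
qed

text \<open>A nearly optimal \<open>z\<close> at time \<open>t - R\<close> satisfies the hypothesis
  of \<open>energy_decay\<close>, so the cost of reaching it is of order
  \<open>\<theta> ^ k\<close>. The upper inequality from \<open>(t - R, z)\<close> to the nearby
  point \<open>(s, x')\<close> then costs about as much.\<close>

lemma oscillation_decay:
  fixes A \<mu> \<theta> K :: real
  assumes A: "A = C * 2 powr q / \<kappa>"
    and \<mu>: "0 < \<mu>" "\<mu> \<le> 1/2" "A * \<mu> powr (q - 1) \<le> 1/2"
    and \<theta>: "\<theta> = (A - 3/4) / (A - 1/2)" "\<mu> \<le> \<theta>"
    and K: "K \<ge> 2 * M" "K \<ge> 4 * (A + 2) * D * h"
    and h: "0 < h" "h < t" "t < T" "s < T"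
    and near: "\<bar>t - s\<bar> \<le> h * \<mu> ^ k / 2" "dist x x' \<le> h * \<mu> ^ k"
  shows "u (s, x') - u (t, x) \<le> (3 * D * h + C * 4 powr q * (h + (K + D * h) / \<kappa>)) * \<theta> ^ k"
proof -
  define R where "R = h * \<mu> ^ k"
  have R: "0 < R" using \<mu> h by (simp add: R_def)
  have "\<mu> ^ k \<le> 1" using \<mu> by (simp add: power_le_one)
  then have Rh: "R \<le> h" using h by (simp add: R_def)
  have R\<theta>: "R \<le> h * \<theta> ^ k"
    unfolding R_def using \<mu> \<theta>(2) h by (intro mult_left_mono power_mono) auto
  obtain z where z: "u (t - R, z) + \<kappa> * cost q (dist x z) R - D * R \<le> u (t, x)"
    using lower[of "t - R" t x] R Rh h by auto
  define b where "b = dist x z"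
  have "u (t, x) - u (t - R, z) \<le> K * \<theta> ^ k"
    unfolding R_def using z by (intro energy_decay[OF A \<mu> \<theta>(1) K h(1-3)]) (simp add: R_def)
  then have "\<kappa> * cost q b R \<le> K * \<theta> ^ k + D * R"
    using z by (simp add: b_def)
  then have b: "cost q b R \<le> (K * \<theta> ^ k + D * R) / \<kappa>"
    using \<kappa> by (simp add: field_simps)
  \<comment> \<open>Since \<open>s\<close> is within \<open>R / 2\<close> of \<open>t\<close>, the
    available time \<open>\<tau>\<close> stays comparable to \<open>R\<close>.\<close>
  define \<tau> where "\<tau> = s - (t - R)"
  have \<tau>: "R / 2 \<le> \<tau>" "\<tau> \<le> 2 * R" "0 < \<tau>"
    using near(1) R unfolding \<tau>_def R_def by linarith+
  have "cost q (dist x' z) \<tau> \<le> cost q (dist x' z) (R / 2)"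
    using \<tau> R q by (intro cost_antimono_time) auto
  also have "\<dots> \<le> 2 powr q * cost q (dist x' z) R"
    using R q by (intro cost_half) auto
  also have "cost q (dist x' z) R \<le> cost q (dist x x' + b) R"
    using R q by (intro cost_mono) (auto simp: b_def dist_triangle3)
  also have "\<dots> \<le> 2 powr q * (cost q (dist x x') R + cost q b R)"
    using R q by (intro cost_double) (auto simp: b_def)
  also have "cost q (dist x x') R \<le> R"
    using near(2) R q by (intro cost_le_time) (auto simp: R_def)
  finally have "cost q (dist x' z) \<tau> \<le> (2 powr q * 2 powr q) * (R + cost q b R)"
    by simp
  also have "2 powr q * 2 powr q = (4::real) powr q"
    using powr_mult[of 2 2 q] by simp
  also have "R + cost q b R \<le> h * \<theta> ^ k + (K * \<theta> ^ k + D * (h * \<theta> ^ k)) / \<kappa>"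
    using b R\<theta> \<kappa> D
    by (intro add_mono order_trans[OF b] divide_right_mono add_left_mono mult_left_mono) auto
  also have "\<dots> = (h + (K + D * h) / \<kappa>) * \<theta> ^ k"
    by (simp add: add_divide_distrib algebra_simps)
  finally have "C * cost q (dist x' z) \<tau> \<le> C * (4 powr q * ((h + (K + D * h) / \<kappa>) * \<theta> ^ k))"
    using C by (intro mult_left_mono) auto
  moreover have "u (s, x') \<le> u (t - R, z) + C * cost q (dist x' z) \<tau> + D * \<tau>"
    using upper[of "t - R" s x' z] \<tau> R Rh h by (simp add: \<tau>_def)
  moreover have "D * \<tau> + D * R \<le> D * (3 * (h * \<theta> ^ k))"
    using D \<tau> R\<theta> by (subst distrib_left[symmetric]) (intro mult_left_mono, auto)
  moreover have "0 \<le> \<kappa> * cost q (dist x z) R"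
    using \<kappa> R by (simp add: cost_nonneg)
  ultimately show ?thesis using z by (simp add: algebra_simps)
qed

end

text \<open>The exponent solves \<open>\<mu> powr \<alpha> = \<theta>\<close>, so
  \<open>\<theta> ^ n\<close> is the power \<open>\<alpha>\<close> of the scale
  \<open>\<mu> ^ n\<close>. Distances above \<open>r\<close> are covered by the bound
  \<open>2 * M\<close>.\<close>

lemma geometric_modulus_imp_holder:
  fixes f :: "'a::metric_space \<Rightarrow> real"
  assumes "0 < \<mu>" "\<mu> < \<theta>" "\<theta> < 1" "0 < r" "0 \<le> K"
    and bdd: "\<bar>f z\<bar> \<le> M" "\<bar>f w\<bar> \<le> M"
    and step: "\<And>k. dist z w \<le> r * \<mu> ^ k \<Longrightarrow> \<bar>f z - f w\<bar> \<le> K * \<theta> ^ k"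
    and \<alpha>: "\<alpha> = ln \<theta> / ln \<mu>"
  shows "\<bar>f z - f w\<bar> \<le> (K / \<theta> + 2 * M) / r powr \<alpha> * dist z w powr \<alpha>"
proof (cases "z = w")
  case True
  then show ?thesis by simp
next
  case False
  define d where "d = dist z w"
  have d: "0 < d" using False by (simp add: d_def)
  have "0 < \<alpha>" using assms by (simp add: \<alpha> divide_neg_neg)
  have M: "0 \<le> M" using bdd(1) by linarith
  have "\<bar>f z - f w\<bar> \<le> (K / \<theta> + 2 * M) * (d / r) powr \<alpha>"
  proof (cases "d \<le> r")
    case False
    then have "1 powr \<alpha> \<le> (d / r) powr \<alpha>"
      using \<open>0 < \<alpha>\<close> assms by (intro powr_mono2) auto
    then have "2 * M * 1 \<le> (K / \<theta> + 2 * M) * (d / r) powr \<alpha>"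
      using M assms by (intro mult_mono) auto
    then show ?thesis using bdd by linarith
  next
    case True
    \<comment> \<open>For the least such \<open>n\<close>, the scale \<open>n - 1\<close> still
      contains the pair; the shift by one costs the factor \<open>1 / \<theta>\<close>.\<close>
    have "\<exists>n. \<mu> ^ n < d / r"
      using assms d by (intro real_arch_pow_inv) auto
    then obtain n where n: "\<mu> ^ n < d / r" "\<And>m. m < n \<Longrightarrow> \<not> \<mu> ^ m < d / r"
      using exists_least_iff[of "\<lambda>n. \<mu> ^ n < d / r"] by auto
    have "n \<noteq> 0" using n(1) True assms by (intro notI) (simp add: field_simps)
    then obtain k where k: "n = Suc k" by (cases n) auto
    have "d \<le> r * \<mu> ^ k" using n(2)[of k] k assms by (simp add: field_simps)
    then have "\<bar>f z - f w\<bar> \<le> K * \<theta> ^ k" using step by (simp add: d_def)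
    also have "\<dots> = K / \<theta> * \<theta> ^ n" using assms k by simp
    also have "\<dots> \<le> (K / \<theta> + 2 * M) * (d / r) powr \<alpha>"
    proof (rule mult_mono)
      have "\<mu> powr \<alpha> = \<theta>" using assms by (simp add: powr_def)
      then have "\<theta> ^ n = (\<mu> ^ n) powr \<alpha>" using assms
        by (metis powr_realpow powr_powr_swap less_trans)
      also have "\<dots> \<le> (d / r) powr \<alpha>"
        using n(1) assms \<open>0 < \<alpha>\<close> by (intro powr_mono2) auto
      finally show "\<theta> ^ n \<le> (d / r) powr \<alpha>" .
    qed (use assms M in auto)
    finally show ?thesis .
  qed
  then show ?thesis using assms d by (simp add: powr_divide d_def)
qed

lemma action_bounds_imp_holder:
  fixes q C \<kappa> D M \<delta> :: real
  assumes q: "1 < q" and C: "1 \<le> C" and \<kappa>: "0 < \<kappa>" "\<kappa> \<le> 1" and D: "0 \<le> D"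
    and M: "0 \<le> M" and \<delta>: "0 < \<delta>"
  shows "\<exists>\<alpha> L. 0 < \<alpha> \<and> \<alpha> < 1 \<and> (\<forall>T (u :: real \<times> 'a::metric_space \<Rightarrow> real).
      action_bounds u T q C \<kappa> D M \<longrightarrow>
      (\<forall>z\<in>{\<delta>..<T} \<times> UNIV. \<forall>w\<in>{\<delta>..<T} \<times> UNIV. \<bar>u z - u w\<bar> \<le> L * dist z w powr \<alpha>))"
proof -
  define A where "A = C * 2 powr q / \<kappa>"
  have "2 powr 1 \<le> 2 powr q" using q by (intro powr_mono) auto
  then have "2 * 1 \<le> 2 powr q * C" using C by (intro mult_mono) auto
  moreover have "C * 2 powr q / 1 \<le> C * 2 powr q / \<kappa>"
    using \<kappa> C by (intro divide_left_mono) auto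
  ultimately have A2: "2 \<le> A" by (simp add: A_def mult.commute)
  \<comment> \<open>The second entry solves \<open>A * \<mu> powr (q - 1) = 1/2\<close>.\<close>
  define \<mu> where "\<mu> = min (1/2) ((1 / (2 * A)) powr (1 / (q - 1)))"
  have \<mu>: "0 < \<mu>" "\<mu> \<le> 1/2" using A2 by (auto simp: \<mu>_def)
  have "\<mu> powr (q - 1) \<le> ((1 / (2 * A)) powr (1 / (q - 1))) powr (q - 1)"
    using \<mu> q by (intro powr_mono2) (auto simp: \<mu>_def)
  also have "\<dots> = 1 / (2 * A)" using q A2 by (simp add: powr_powr)
  finally have \<mu>A: "A * \<mu> powr (q - 1) \<le> 1/2" using A2 by (simp add: field_simps)
  define \<theta> where "\<theta> = (A - 3/4) / (A - 1/2)"
  have \<theta>: "1/2 < \<theta>" "\<theta> < 1" using A2 by (auto simp: \<theta>_def field_simps)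
  \<comment> \<open>Times \<open>t \<ge> \<delta>\<close> then leave room to go back by
    \<open>h\<close>.\<close>
  define h where "h = \<delta> / 2"
  define K where "K = 2 * M + 4 * (A + 2) * D * h"
  have h: "0 < h" using \<delta> by (simp add: h_def)
  have K: "K \<ge> 2 * M" "K \<ge> 4 * (A + 2) * D * h"
    using M A2 D h by (auto simp: K_def)
  define K' where "K' = 3 * D * h + C * 4 powr q * (h + (K + D * h) / \<kappa>)"
  have K': "0 \<le> K'" using K M D h C \<kappa> by (simp add: K'_def)
  define \<alpha> where "\<alpha> = ln \<theta> / ln \<mu>"
  have ln\<mu>: "ln \<mu> < 0" using \<mu> by simp
  have "ln \<mu> < ln \<theta>" using \<mu> \<theta> by simp
  then have \<alpha>: "0 < \<alpha>" "\<alpha> < 1"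
    using ln\<mu> \<theta> by (auto simp: \<alpha>_def divide_neg_neg neg_divide_less_eq)
  have "\<bar>u z - u w\<bar> \<le> (K' / \<theta> + 2 * M) / (h / 2) powr \<alpha> * dist z w powr \<alpha>"
    if ab: "action_bounds u T q C \<kappa> D M" and z: "z \<in> {\<delta>..<T} \<times> UNIV" and w: "w \<in> {\<delta>..<T} \<times> UNIV"
    for T and u :: "real \<times> 'a \<Rightarrow> real" and z w
  proof (rule geometric_modulus_imp_holder[of \<mu> \<theta> "h / 2" K' u z M w \<alpha>])
    interpret action_bounds u T q C \<kappa> D M by (rule ab)
    show "\<bar>u z\<bar> \<le> M" "\<bar>u w\<bar> \<le> M" using bdd[of "fst z" "snd z"] bdd[of "fst w" "snd w"] z w \<delta>
      by (auto simp: mem_Times_iff)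
    \<comment> \<open>The radius carries \<open>1/2\<close> because the time difference may be at
      most half the scale. The estimate is one-sided and is later applied to both orders of the
      pair.\<close>
    have osc: "u w - u z \<le> K' * \<theta> ^ k"
      if d: "dist z w \<le> h / 2 * \<mu> ^ k" and z: "z \<in> {\<delta>..<T} \<times> UNIV" and w: "w \<in> {\<delta>..<T} \<times> UNIV"
      for k z w
    proof -
      obtain t x s x' where eq: "z = (t, x)" "w = (s, x')" by fastforce
      have "\<bar>t - s\<bar> \<le> dist z w" "dist x x' \<le> dist z w"
        using dist_fst_le[of z w] dist_snd_le[of z w] by (auto simp: eq dist_real_def)
      moreover have "0 \<le> h * \<mu> ^ k" using h \<mu> by simp
      ultimately have "\<bar>t - s\<bar> \<le> h * \<mu> ^ k / 2" "dist x x' \<le> h * \<mu> ^ k"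
        using d by auto
      then show ?thesis unfolding eq K'_def
        using z w \<delta> \<mu> \<theta> h
        by (intro oscillation_decay[OF A_def \<mu> \<mu>A \<theta>_def _ K]) (auto simp: eq h_def)
    qed
    show "\<bar>u z - u w\<bar> \<le> K' * \<theta> ^ k" if d: "dist z w \<le> h / 2 * \<mu> ^ k" for k
    proof -
      have "dist w z \<le> h / 2 * \<mu> ^ k" using d by (simp add: dist_commute)
      then have "u z - u w \<le> K' * \<theta> ^ k" by (rule osc[OF _ w z])
      moreover have "u w - u z \<le> K' * \<theta> ^ k" by (rule osc[OF d z w])
      ultimately show ?thesis by linarith
    qed
    show "0 < \<mu>" "\<mu> < \<theta>" "\<theta> < 1" "0 < h / 2" "0 \<le> K'" "\<alpha> = ln \<theta> / ln \<mu>"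
      using \<mu> \<theta> h K' by (auto simp: \<alpha>_def)
  qed
  then show ?thesis using \<alpha> by blast
qed

section \<open>Action bounds for viscosity sub- and supersolutions\<close>

text \<open>The value at \<open>z0\<close> excludes a maximum over \<open>S\<close> on
  \<open>S - U\<close>, and openness of \<open>U\<close> makes the maximum a genuine local
  one.\<close>

lemma compact_imp_local_max:
  fixes f :: "'a::topological_space \<Rightarrow> real"
  assumes "compact S" "continuous_on S f" "open U" "U \<subseteq> S" "z0 \<in> S"
    and "\<And>w. w \<in> S - U \<Longrightarrow> f w < f z0"
  shows "\<exists>z\<in>U. local_max_at f z"
proof -
  obtain z where z: "z \<in> S" "\<And>w. w \<in> S \<Longrightarrow> f w \<le> f z"
    using continuous_attains_sup[OF assms(1) _ assms(2)] assms(5) by blast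
  then have "z \<in> U" using assms(5,6) by fastforce
  moreover have "local_max_at f z"
    unfolding local_max_at_def eventually_nhds using assms z \<open>z \<in> U\<close> by blast
  ultimately show ?thesis by blast
qed

lemma compact_imp_local_min:
  fixes f :: "'a::topological_space \<Rightarrow> real"
  assumes "compact S" "continuous_on S f" "open U" "U \<subseteq> S" "z0 \<in> S"
    and "\<And>w. w \<in> S - U \<Longrightarrow> f z0 < f w"
  shows "\<exists>z\<in>U. local_min_at f z"
  using compact_imp_local_max[of S "\<lambda>z. - f z" U z0] assms
  by (auto simp: local_max_at_def local_min_at_def intro: continuous_intros)

text \<open>A non-sharp Young inequality whose first term matches the lower growth bound of
  \<open>H\<close>. The cases compare \<open>\<Lambda> * b\<close> with
  \<open>a powr (p - 1)\<close>, and each term alone suffices in one of them.\<close>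

lemma young_powr:
  fixes a b p \<Lambda> :: real
  assumes "0 \<le> a" "0 \<le> b" "1 < p" "0 < \<Lambda>" "q = p / (p - 1)"
  shows "a * b \<le> a powr p / \<Lambda> + \<Lambda> powr (q - 1) * b powr q"
proof (cases "a = 0")
  case True
  then show ?thesis using assms by simp
next
  case False
  then have a: "0 < a" using assms by simp
  show ?thesis
  proof (cases "\<Lambda> * b \<le> a powr (p - 1)")
    case True
    have "a * b = a * (\<Lambda> * b) / \<Lambda>" using assms by simp
    also have "\<dots> \<le> a * a powr (p - 1) / \<Lambda>"
      using True a assms by (intro divide_right_mono mult_left_mono) auto
    also have "a * a powr (p - 1) = a powr p" using a by (simp add: powr_diff)
    finally show ?thesis using assms by (simp add: add_increasing2)
  next
    case False
    then have b: "0 < b" using assms by (cases "b = 0") auto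
    have q1: "q - 1 = 1 / (p - 1)" using assms by (simp add: field_simps)
    have "a = (a powr (p - 1)) powr (q - 1)"
      unfolding q1 using a assms by (simp add: powr_powr)
    also have "\<dots> \<le> (\<Lambda> * b) powr (q - 1)"
      unfolding q1 using False assms by (intro powr_mono2) auto
    also have "\<dots> = \<Lambda> powr (q - 1) * b powr (q - 1)"
      using assms by (simp add: powr_mult)
    finally have "a * b \<le> \<Lambda> powr (q - 1) * b powr (q - 1) * b"
      using b by (intro mult_right_mono) auto
    also have "\<dots> = \<Lambda> powr (q - 1) * b powr q" using b by (simp add: powr_diff)
    finally show ?thesis using assms by (simp add: add_increasing)
  qed
qed

text \<open>
  Along a line of velocity \<open>v\<close>, Young's inequality turns the equation into
  \<open>d/d\<tau> u \<le> \<Lambda> + \<Lambda>\<^sup>q\<^sup>-\<^sup>1 |v|\<^sup>q\<close>. The restriction to the line is realised by a quadratic penalty,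
  and the exponential keeps the maximum away from the final time.
\<close>

lemma subsolution_upper_bound:
  fixes u :: "real \<times> (real ^ 'n) \<Rightarrow> real"
  assumes sub: "viscosity_subsolution ({0<..<T} \<times> UNIV) H u"
    and H: "\<And>t x P. 0 < t \<Longrightarrow> t < T \<Longrightarrow> 1 / \<Lambda> * norm P powr p - \<Lambda> \<le> H t x P"
    and bdd: "\<And>t x. 0 < t \<Longrightarrow> t < T \<Longrightarrow> \<bar>u (t, x)\<bar> \<le> M"
    and p: "1 < p" "q = p / (p - 1)" and \<Lambda>: "0 < \<Lambda>"
    and st: "0 < s" "s < t" "t < T"
  shows "u (t, x) \<le> u (s, y) + \<Lambda> powr (q - 1) * cost q (dist x y) (t - s) + 2 * \<Lambda> * (t - s)"
proof (rule ccontr)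
  assume neg: "\<not> ?thesis"
  let ?\<Omega> = "{0<..<T} \<times> (UNIV :: (real ^ 'n) set)"
  define v where "v = (1 / (t - s)) *\<^sub>R (x - y)"
  \<comment> \<open>The slope exceeds the rate given by Young's inequality by
    \<open>\<Lambda>\<close>, which makes the final contradiction strict.\<close>
  define K where "K = 2 * \<Lambda> + \<Lambda> powr (q - 1) * norm v powr q"
  define l where "l = (\<lambda>\<tau>. y + (\<tau> - s) *\<^sub>R v)"
  have lt: "l t = x" and ls: "l s = y" using st by (auto simp: l_def v_def)
  have K0: "0 \<le> K" using \<Lambda> by (simp add: K_def)
  have contu: "continuous_on ?\<Omega> u" using sub by (simp add: viscosity_subsolution_def)
  \<comment> \<open>The excess in the negated claim: half is spent on the exponential at time
    \<open>t\<close>, and half on the variation of \<open>u\<close> near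
    \<open>(s, y)\<close>.\<close>
  define \<gamma> where "\<gamma> = u (t, x) - K * (t - s) - u (s, y)"
  have "norm v = dist x y / (t - s)" using st by (simp add: v_def dist_norm)
  then have \<gamma>: "0 < \<gamma>"
    using neg by (simp add: \<gamma>_def K_def cost_def algebra_simps)
  have "isCont u (s, y)"
    using contu st by (simp add: continuous_on_eq_continuous_at open_Times)
  then have "((\<lambda>\<xi>. u (s, \<xi>)) \<longlongrightarrow> u (s, y)) (at y)"
    by (intro isCont_tendsto_compose[of "(s, y)" u]) (auto intro!: tendsto_intros)
  then obtain d where d: "0 < d" "\<And>\<xi>. \<xi> \<noteq> y \<Longrightarrow> dist \<xi> y < d \<Longrightarrow> \<bar>u (s, \<xi>) - u (s, y)\<bar> < \<gamma> / 2"
    using \<gamma> unfolding LIM_def dist_real_def by (metis half_gt_zero)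
  define \<rho> where "\<rho> = d / 2"
  have \<rho>: "0 < \<rho>" "\<And>\<xi>. dist \<xi> y \<le> \<rho> \<Longrightarrow> u (s, \<xi>) < u (s, y) + \<gamma> / 2"
  proof -
    show "0 < \<rho>" using d by (simp add: \<rho>_def)
    show "u (s, \<xi>) < u (s, y) + \<gamma> / 2" if "dist \<xi> y \<le> \<rho>" for \<xi>
    proof (cases "\<xi> = y")
      case False
      then have "\<bar>u (s, \<xi>) - u (s, y)\<bar> < \<gamma> / 2" using that d by (intro d(2)) (auto simp: \<rho>_def)
      then show ?thesis by linarith
    qed (use \<gamma> in simp)
  qed
  define t' where "t' = (t + T) / 2"
  have t': "t < t'" "t' < T" using st by (auto simp: t'_def)
  define m where "m = 2 * M + K * (t - s) + 1 + \<gamma>"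
  have M0: "0 \<le> M" using bdd[of t x] st by auto
  have m0: "0 < m" using M0 K0 \<gamma> st by (simp add: m_def add_nonneg_pos)
  \<comment> \<open>By \<open>exp x \<ge> x\<close>, the exponential term reaches \<open>m\<close>,
    which exceeds the oscillation of \<open>u\<close>, at time \<open>t'\<close>. Below,
    \<open>\<beta>\<close> does the same on the lateral boundary of the tube.\<close>
  define B where "B = m / (\<gamma> / 2 * (t' - t))"
  have B: "0 \<le> B" "m \<le> \<gamma> / 2 * exp (B * (t' - t))"
  proof -
    show "0 \<le> B" using m0 \<gamma> t' by (simp add: B_def)
    have "m = \<gamma> / 2 * (B * (t' - t))" using \<gamma> t' by (simp add: B_def)
    also have "\<dots> \<le> \<gamma> / 2 * exp (B * (t' - t))"
      using exp_ge_add_one_self[of "B * (t' - t)"] \<gamma>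
      by (intro mult_left_mono; linarith)
    finally show "m \<le> \<gamma> / 2 * exp (B * (t' - t))" .
  qed
  define \<beta> where "\<beta> = m / \<rho>\<^sup>2"
  have \<beta>: "0 \<le> \<beta>" "\<beta> * \<rho>\<^sup>2 = m" using m0 \<rho> by (auto simp: \<beta>_def)
  define \<phi> where "\<phi> = (\<lambda>z. K * (fst z - s) + \<gamma> / 2 * exp (B * (fst z - t))
      + \<beta> * ((snd z - l (fst z)) \<bullet> (snd z - l (fst z))))"
  define g where "g = (\<lambda>z. (2 * \<beta>) *\<^sub>R (snd z - l (fst z)))"
  \<comment> \<open>The term \<open>- g z \<bullet> v\<close> arises because the centre of the
    penalty moves with velocity \<open>v\<close>.\<close>
  define a where "a = (\<lambda>z. K + \<gamma> / 2 * B * exp (B * (fst z - t)) - g z \<bullet> v)"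
  have test: "C1_test ?\<Omega> \<phi> a g"
    unfolding C1_test_def
  proof (intro conjI ballI)
    show "continuous_on ?\<Omega> g" unfolding g_def l_def by (intro continuous_intros)
    then show "continuous_on ?\<Omega> a" unfolding a_def by (intro continuous_intros)
    show "(\<phi> has_derivative (\<lambda>w. a z * fst w + g z \<bullet> snd w)) (at z)" for z
      unfolding \<phi>_def l_def
      by (auto intro!: derivative_eq_intros ext
          simp: a_def g_def l_def algebra_simps inner_commute inner_diff_right inner_add_right)
  qed
  define S where "S = {z. s \<le> fst z \<and> fst z \<le> t' \<and> norm (snd z - l (fst z)) \<le> \<rho>}"
  define U where "U = {z. s < fst z \<and> fst z < t' \<and> norm (snd z - l (fst z)) < \<rho>}"
  have S\<Omega>: "S \<subseteq> ?\<Omega>" using st t' by (auto simp: S_def)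
  have "closed S" unfolding S_def l_def
    by (intro closed_Collect_conj closed_Collect_le continuous_intros)
  moreover have "bounded S"
  proof -
    have "S \<subseteq> {s..t'} \<times> cball y (\<rho> + (t' - s) * norm v)"
    proof
      fix z assume z: "z \<in> S"
      have "norm (y - snd z) \<le> norm (snd z - l (fst z)) + norm ((fst z - s) *\<^sub>R v)"
        using norm_triangle_ineq[of "snd z - l (fst z)" "(fst z - s) *\<^sub>R v"]
        by (simp add: l_def norm_minus_commute)
      also have "\<dots> \<le> \<rho> + (t' - s) * norm v"
        using z by (auto simp: S_def intro!: add_mono mult_right_mono)
      finally show "z \<in> {s..t'} \<times> cball y (\<rho> + (t' - s) * norm v)"
        using z by (auto simp: S_def mem_Times_iff dist_norm)
    qed
    then show ?thesis
      by (rule bounded_subset[rotated]) (intro bounded_Times bounded_closed_interval bounded_cball)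
  qed
  ultimately have cS: "compact S" by (simp add: compact_eq_bounded_closed)
  have oU: "open U" unfolding U_def l_def
    by (intro open_Collect_conj open_Collect_less continuous_intros)
  have cont: "continuous_on S (\<lambda>w. u w - \<phi> w)"
    unfolding \<phi>_def l_def
    by (intro continuous_intros continuous_on_subset[OF contu S\<Omega>])
  have top: "u (t, x) - \<phi> (t, x) = u (s, y) + \<gamma> / 2"
    by (simp add: \<phi>_def lt \<gamma>_def field_simps)
  have "\<exists>z\<in>U. local_max_at (\<lambda>w. u w - \<phi> w) z"
  proof (rule compact_imp_local_max[OF cS cont oU, of "(t, x)"])
    show "U \<subseteq> S" by (auto simp: U_def S_def)
    show "(t, x) \<in> S" using st t' \<rho> by (simp add: S_def lt)
    fix w assume w: "w \<in> S - U"
    obtain \<tau> \<xi> where wq: "w = (\<tau>, \<xi>)" by fastforce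
    have \<tau>: "s \<le> \<tau>" "\<tau> \<le> t'" "norm (\<xi> - l \<tau>) \<le> \<rho>" using w by (auto simp: S_def wq)
    have pos: "0 \<le> K * (\<tau> - s)" "0 < \<gamma> / 2 * exp (B * (\<tau> - t))"
        "0 \<le> \<beta> * ((\<xi> - l \<tau>) \<bullet> (\<xi> - l \<tau>))"
      using \<tau> K0 \<gamma> \<beta> by auto
    have \<phi>w: "\<phi> w = K * (\<tau> - s) + \<gamma> / 2 * exp (B * (\<tau> - t)) + \<beta> * ((\<xi> - l \<tau>) \<bullet> (\<xi> - l \<tau>))"
      by (simp add: \<phi>_def wq)
    have uw: "u w \<le> M" using bdd[of \<tau> \<xi>] \<tau> st t' by (auto simp: wq)
    have uM: "- M \<le> u (s, y)" using bdd[of s y] st by auto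
    have mM: "2 * M < m" using K0 \<gamma> st by (simp add: m_def add_nonneg_pos)
    consider "\<tau> = s" | "\<tau> = t'" | "norm (\<xi> - l \<tau>) = \<rho>"
      using w by (fastforce simp: S_def U_def wq)
    then show "u w - \<phi> w < u (t, x) - \<phi> (t, x)"
    proof cases
      case 1
      then have "u w < u (s, y) + \<gamma> / 2" using \<rho>(2)[of \<xi>] \<tau>(3) by (simp add: wq ls dist_norm)
      then show ?thesis unfolding top \<phi>w using pos by linarith
    next
      case 2
      then have "m \<le> \<gamma> / 2 * exp (B * (\<tau> - t))" using B by simp
      then show ?thesis unfolding top \<phi>w using pos uw uM mM \<gamma> by linarith
    next
      case 3
      then have "m = \<beta> * ((\<xi> - l \<tau>) \<bullet> (\<xi> - l \<tau>))" using \<beta>(2) by (simp add: power2_norm_eq_inner[symmetric])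
      then show ?thesis unfolding top \<phi>w using pos uw uM mM \<gamma> by linarith
    qed
  qed
  then obtain z where z: "z \<in> U" "local_max_at (\<lambda>w. u w - \<phi> w) z" by blast
  have z\<Omega>: "z \<in> ?\<Omega>" using z(1) st t' by (auto simp: U_def mem_Times_iff)
  have "a z + H (fst z) (snd z) (g z) \<le> 0"
    using sub test z\<Omega> z(2) unfolding viscosity_subsolution_def by blast
  moreover have "1 / \<Lambda> * norm (g z) powr p - \<Lambda> \<le> H (fst z) (snd z) (g z)"
    using H z\<Omega> by (auto simp: mem_Times_iff)
  moreover have "g z \<bullet> v \<le> norm (g z) powr p / \<Lambda> + \<Lambda> powr (q - 1) * norm v powr q"
    using norm_cauchy_schwarz[of "g z" v] young_powr[of "norm (g z)" "norm v" p \<Lambda> q] p \<Lambda>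
    by fastforce
  moreover have "0 \<le> \<gamma> / 2 * B * exp (B * (fst z - t))" using \<gamma> B by simp
  ultimately show False using \<Lambda> by (simp add: a_def K_def)
qed

lemma square_powr_half: "0 \<le> x \<Longrightarrow> (x\<^sup>2) powr (q / 2) = x powr q" for x q :: real
  by (cases "x = 0") (simp_all add: powr_def ln_realpow)

text \<open>
  The comparison function \<open>- \<kappa> (h\<^sup>2 + |\<xi> - x|\<^sup>2)\<^bsup>q/2\<^esup> h\<^sup>-\<^sup>q (\<tau> - s + h)\<close> is a smooth substitute for the
  singular Hopf--Lax solution: being affine in \<open>\<tau>\<close>, it is a strict subsolution up to time \<open>t + h\<close>
  and \<open>C\<^sup>1\<close> for all times.
\<close>

lemma supersolution_lower_bound:
  fixes u :: "real \<times> (real ^ 'n) \<Rightarrow> real"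
  assumes super: "viscosity_supersolution ({0<..<T} \<times> UNIV) H u"
    and H: "\<And>t x P. 0 < t \<Longrightarrow> t < T \<Longrightarrow> H t x P \<le> \<Lambda> * norm P powr p + \<Lambda>"
    and bdd: "\<And>t x. 0 < t \<Longrightarrow> t < T \<Longrightarrow> \<bar>u (t, x)\<bar> \<le> M"
    and p: "1 < p" "q = p / (p - 1)" and \<Lambda>: "1 \<le> \<Lambda>"
    and \<kappa>: "0 < \<kappa>" "\<kappa> \<le> 1" "\<Lambda> * (3 * \<kappa> * q) powr p \<le> \<kappa>"
    and st: "0 < s" "s < t" "t < T"
  shows "\<exists>y. u (s, y) + \<kappa> * cost q (dist x y) (t - s) - 5 * \<Lambda> * (t - s) \<le> u (t, x)"
proof (rule ccontr)
  assume "\<not> ?thesis"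
  then have neg: "u (t, x) < u (s, y) + \<kappa> * cost q (dist x y) (t - s) - 5 * \<Lambda> * (t - s)" for y
    by (simp add: not_le)
  let ?\<Omega> = "{0<..<T} \<times> (UNIV :: (real ^ 'n) set)"
  define h where "h = t - s"
  have h: "0 < h" using st by (simp add: h_def)
  have q: "1 < q" using p(1) unfolding p(2) by (simp add: less_divide_eq)
  have contu: "continuous_on ?\<Omega> u" using super by (simp add: viscosity_supersolution_def)
  have M0: "0 \<le> M" using bdd[of t x] st by auto
  \<comment> \<open>The cap \<open>t + h\<close> keeps \<open>\<tau> - s + h \<le> 3 * h\<close>,
    hence the 3 in the condition on \<open>\<kappa>\<close>.\<close>
  define t' where "t' = min (t + h) ((t + T) / 2)"
  have t': "t < t'" "t' < T" "t' \<le> t + h" using st h by (auto simp: t'_def min_less_iff_disj)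
  define m where "m = 2 * M + 5 * \<Lambda> * h + 1"
  have m0: "0 < m" using M0 \<Lambda> h by (simp add: m_def add_nonneg_pos)
  define B where "B = m / (\<Lambda> * h * (t' - t))"
  have B: "0 \<le> B" "m \<le> \<Lambda> * h * exp (B * (t' - t))"
  proof -
    show "0 \<le> B" using m0 \<Lambda> h t' by (simp add: B_def)
    have "m = \<Lambda> * h * (B * (t' - t))" using \<Lambda> h t' by (simp add: B_def)
    also have "\<dots> \<le> \<Lambda> * h * exp (B * (t' - t))"
    proof (rule mult_left_mono)
      show "B * (t' - t) \<le> exp (B * (t' - t))"
        using exp_ge_add_one_self[of "B * (t' - t)"] by linarith
    qed (use \<Lambda> h in simp)
    finally show "m \<le> \<Lambda> * h * exp (B * (t' - t))" .
  qed
  \<comment> \<open>Adding \<open>h\<^sup>2\<close> keeps \<open>W\<close> positive, so its powers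
    are smooth even where the exponent \<open>q / 2 - 1\<close> is negative.\<close>
  define W where "W = (\<lambda>\<xi>. h\<^sup>2 + (\<xi> - x) \<bullet> (\<xi> - x))"
  have W: "0 < W \<xi>" "h\<^sup>2 \<le> W \<xi>" "(norm (\<xi> - x))\<^sup>2 \<le> W \<xi>" for \<xi>
    using h by (auto simp: W_def add_pos_nonneg power2_norm_eq_inner)
  have Wq: "norm (\<xi> - x) powr q \<le> W \<xi> powr (q / 2)" for \<xi>
  proof -
    have "norm (\<xi> - x) powr q = ((norm (\<xi> - x))\<^sup>2) powr (q / 2)"
      by (simp add: square_powr_half)
    also have "\<dots> \<le> W \<xi> powr (q / 2)" using W q by (intro powr_mono2) auto
    finally show ?thesis .
  qed
  define c where "c = \<kappa> * h powr (- q)"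
  have c: "0 < c" using \<kappa> h by (simp add: c_def)
  have cost: "\<kappa> * cost q (dist x \<xi>) h \<le> c * W \<xi> powr (q / 2) * h" for \<xi>
  proof -
    have "cost q (dist x \<xi>) h = norm (\<xi> - x) powr q * (h powr (- q) * h)"
      using h by (simp add: cost_eq dist_norm norm_minus_commute powr_diff powr_minus divide_simps)
    also have "\<dots> \<le> W \<xi> powr (q / 2) * (h powr (- q) * h)"
      using Wq h by (intro mult_right_mono) auto
    finally show ?thesis using \<kappa> by (simp add: c_def ac_simps)
  qed
  \<comment> \<open>The constant \<open>5 * \<Lambda> * h\<close> cancels in the negated claim at
    time \<open>s\<close>. At \<open>(t, x)\<close> it covers the drift
    \<open>2 * \<Lambda> * h\<close>, the exponential \<open>\<Lambda> * h\<close> and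
    \<open>2 * \<kappa> * h\<close>.\<close>
  define \<phi> where "\<phi> = (\<lambda>z. u (t, x) + 5 * \<Lambda> * h - 2 * \<Lambda> * (fst z - s)
      - c * W (snd z) powr (q / 2) * (fst z - s + h) - \<Lambda> * h * exp (B * (fst z - t)))"
  define g where "g = (\<lambda>z. (- (c * q * W (snd z) powr (q / 2 - 1) * (fst z - s + h))) *\<^sub>R (snd z - x))"
  define a where "a = (\<lambda>z. - 2 * \<Lambda> - c * W (snd z) powr (q / 2) - \<Lambda> * h * B * exp (B * (fst z - t)))"
  have contW: "continuous_on A (\<lambda>z. W (snd z) powr r)" for A :: "(real \<times> (real ^ 'n)) set" and r
  proof (rule continuous_on_powr)
    show "continuous_on A (\<lambda>z. W (snd z))" unfolding W_def by (intro continuous_intros)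
  qed (use W(1) in \<open>auto simp: less_imp_neq[symmetric]\<close>)
  have dW: "((\<lambda>z. W (snd z) powr (q / 2)) has_derivative
      (\<lambda>w. q * W (snd z) powr (q / 2 - 1) * ((snd z - x) \<bullet> snd w))) (at z)" for z :: "real \<times> (real ^ 'n)"
  proof -
    have "((\<lambda>z. W (snd z)) has_derivative (\<lambda>w. 2 * ((snd z - x) \<bullet> snd w))) (at z)"
      unfolding W_def by (auto intro!: derivative_eq_intros ext simp: inner_commute)
    moreover have "((\<lambda>y. y powr (q / 2)) has_field_derivative (q / 2 * W (snd z) powr (q / 2 - 1))) (at (W (snd z)))"
      using W(1) by (intro has_real_derivative_powr)
    then have "((\<lambda>y. y powr (q / 2)) has_derivative (*) (q / 2 * W (snd z) powr (q / 2 - 1))) (at (W (snd z)))"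
      by (rule has_field_derivative_imp_has_derivative)
    ultimately have "((\<lambda>z. W (snd z) powr (q / 2)) has_derivative
        (\<lambda>w. q / 2 * W (snd z) powr (q / 2 - 1) * (2 * ((snd z - x) \<bullet> snd w)))) (at z)"
      by (rule has_derivative_compose)
    then show ?thesis by (simp add: mult.assoc)
  qed
  have test: "C1_test ?\<Omega> \<phi> a g"
    unfolding C1_test_def
  proof (intro conjI ballI)
    show "continuous_on ?\<Omega> g" unfolding g_def by (intro continuous_intros contW)
    show "continuous_on ?\<Omega> a" unfolding a_def by (intro continuous_intros contW)
    fix z :: "real \<times> (real ^ 'n)"
    show "(\<phi> has_derivative (\<lambda>w. a z * fst w + g z \<bullet> snd w)) (at z)"
    proof -
      define V where "V = (\<lambda>z :: real \<times> (real ^ 'n). W (snd z) powr (q / 2))"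
      have \<phi>V: "\<phi> = (\<lambda>z. u (t, x) + 5 * \<Lambda> * h - 2 * \<Lambda> * (fst z - s)
          - c * V z * (fst z - s + h) - \<Lambda> * h * exp (B * (fst z - t)))"
        by (simp add: \<phi>_def V_def)
      have aV: "a z = - 2 * \<Lambda> - c * V z - \<Lambda> * h * B * exp (B * (fst z - t))"
        by (simp add: a_def V_def)
      show ?thesis
        unfolding \<phi>V aV
        by (auto intro!: derivative_eq_intros dW[of z, folded V_def] ext simp: g_def algebra_simps)
    qed
  qed
  \<comment> \<open>At distance \<open>R\<close> from \<open>x\<close> the power term alone reaches
    \<open>m\<close>.\<close>
  define R where "R = (m / (c * h)) powr (1 / q)"
  have R: "0 < R" "c * R powr q * h = m"
    using m0 c h q by (auto simp: R_def powr_powr)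
  define S where "S = {s..t'} \<times> cball x R"
  define U where "U = {s<..<t'} \<times> ball x R"
  have S\<Omega>: "S \<subseteq> ?\<Omega>" using st t' by (auto simp: S_def)
  have cont: "continuous_on S (\<lambda>w. u w - \<phi> w)"
    unfolding \<phi>_def by (intro continuous_intros contW continuous_on_subset[OF contu S\<Omega>])
  have bottom: "u (t, x) - \<phi> (t, x) \<le> 0"
  proof -
    have "W x powr (q / 2) = h powr q"
      using h by (simp add: W_def square_powr_half)
    then have cW: "c * W x powr (q / 2) = \<kappa>"
      using h by (simp add: c_def powr_minus)
    have "u (t, x) - \<phi> (t, x) = 2 * (\<kappa> * h) - 2 * (\<Lambda> * h)"
      unfolding \<phi>_def snd_conv fst_conv cW by (simp add: h_def algebra_simps)
    moreover have "\<kappa> * h \<le> \<Lambda> * h" using \<kappa> \<Lambda> h by (intro mult_right_mono) auto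
    ultimately show ?thesis by linarith
  qed
  have "\<exists>z\<in>U. local_min_at (\<lambda>w. u w - \<phi> w) z"
  proof (rule compact_imp_local_min[OF _ cont, of _ "(t, x)"])
    show "compact S" unfolding S_def by (intro compact_Times compact_Icc compact_cball)
    show "open U" unfolding U_def by (intro open_Times open_greaterThanLessThan open_ball)
    show "U \<subseteq> S" by (auto simp: U_def S_def)
    show "(t, x) \<in> S" using st t' R by (simp add: S_def)
    fix w assume w: "w \<in> S - U"
    obtain \<tau> \<xi> where wq: "w = (\<tau>, \<xi>)" by fastforce
    have \<tau>: "s \<le> \<tau>" "\<tau> \<le> t'" "dist x \<xi> \<le> R" using w by (auto simp: S_def wq)
    have pos: "0 \<le> 2 * \<Lambda> * (\<tau> - s)" "0 < \<Lambda> * h * exp (B * (\<tau> - t))"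
        "c * W \<xi> powr (q / 2) * h \<le> c * W \<xi> powr (q / 2) * (\<tau> - s + h)"
        "0 \<le> c * W \<xi> powr (q / 2) * h"
      using \<tau> \<Lambda> h c by (auto intro!: mult_left_mono)
    have \<phi>w: "\<phi> w = u (t, x) + 5 * \<Lambda> * h - 2 * \<Lambda> * (\<tau> - s)
        - c * W \<xi> powr (q / 2) * (\<tau> - s + h) - \<Lambda> * h * exp (B * (\<tau> - t))"
      by (simp add: \<phi>_def wq)
    have uw: "- M \<le> u w" using bdd[of \<tau> \<xi>] \<tau> st t' by (auto simp: wq)
    have uM: "u (t, x) \<le> M" using bdd[of t x] st by auto
    consider "\<tau> = s" | "\<tau> = t'" | "dist x \<xi> = R"
      using w by (fastforce simp: S_def U_def wq)
    then have "0 < u w - \<phi> w"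
    proof cases
      case 1
      then have "u (t, x) < u w + c * W \<xi> powr (q / 2) * h - 5 * \<Lambda> * h"
        using neg[of \<xi>] cost[of \<xi>] by (simp add: wq h_def)
      then show ?thesis unfolding \<phi>w using pos by linarith
    next
      case 2
      then have "m \<le> \<Lambda> * h * exp (B * (\<tau> - t))" using B by simp
      then show ?thesis unfolding \<phi>w m_def using pos uw uM by linarith
    next
      case 3
      then have "m \<le> c * W \<xi> powr (q / 2) * h"
        unfolding R(2)[symmetric] using Wq[of \<xi>] c h
        by (intro mult_right_mono mult_left_mono) (auto simp: dist_norm norm_minus_commute)
      then show ?thesis unfolding \<phi>w m_def using pos uw uM by linarith
    qed
    then show "u (t, x) - \<phi> (t, x) < u w - \<phi> w" using bottom by linarith
  qed
  then obtain z where z: "z \<in> U" "local_min_at (\<lambda>w. u w - \<phi> w) z" by blast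
  have z\<Omega>: "z \<in> ?\<Omega>" using z(1) st t' by (auto simp: U_def mem_Times_iff)
  have "0 \<le> a z + H (fst z) (snd z) (g z)"
    using super test z\<Omega> z(2) unfolding viscosity_supersolution_def by blast
  moreover have "H (fst z) (snd z) (g z) \<le> \<Lambda> * norm (g z) powr p + \<Lambda>"
    using H z\<Omega> by (auto simp: mem_Times_iff)
  \<comment> \<open>The time derivative of the comparison function absorbs the Hamiltonian: the
    exponents match as \<open>(1 - q) * p = - q\<close>, and the smallness of
    \<open>\<kappa>\<close> handles the constant.\<close>
  moreover have "\<Lambda> * norm (g z) powr p \<le> c * W (snd z) powr (q / 2)"
  proof -
    define w where "w = W (snd z)"
    have w: "0 < w" using W(1) by (simp add: w_def)
    have "norm (snd z - x) = ((norm (snd z - x))\<^sup>2) powr (1/2)"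
      by (simp add: powr_half_sqrt)
    also have "\<dots> \<le> w powr (1/2)" unfolding w_def using W by (intro powr_mono2) auto
    finally have n: "norm (snd z - x) \<le> w powr (1/2)" .
    have f: "0 \<le> fst z - s + h" "fst z - s + h \<le> 3 * h"
      using z(1) h t' by (auto simp: U_def mem_Times_iff h_def)
    have "norm (g z) = c * q * w powr (q / 2 - 1) * (fst z - s + h) * norm (snd z - x)"
      using c q f by (simp add: g_def w_def)
    also have "\<dots> \<le> c * q * w powr (q / 2 - 1) * (3 * h) * w powr (1/2)"
      using c q f n by (intro mult_mono) auto
    also have "\<dots> = (3 * \<kappa> * q) * (h powr (1 - q) * w powr ((q - 1) / 2))"
    proof -
      have "w powr ((q - 1) / 2) = w powr (q / 2 - 1) * w powr (1/2)"
        by (simp add: diff_divide_distrib flip: powr_add)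
      then show ?thesis using h by (simp add: c_def powr_diff powr_minus divide_simps)
    qed
    finally have "norm (g z) powr p \<le> ((3 * \<kappa> * q) * (h powr (1 - q) * w powr ((q - 1) / 2))) powr p"
      using p by (intro powr_mono2) auto
    also have "\<dots> = (3 * \<kappa> * q) powr p * (h powr (- q) * w powr (q / 2))"
    proof -
      have "(1 - q) * p = - q" "(q - 1) / 2 * p = q / 2" using p by (auto simp: field_simps)
      then show ?thesis using \<kappa> q by (simp add: powr_mult powr_powr)
    qed
    finally have "\<Lambda> * norm (g z) powr p \<le> \<Lambda> * ((3 * \<kappa> * q) powr p * (h powr (- q) * w powr (q / 2)))"
      using \<Lambda> by (intro mult_left_mono) auto
    also have "\<dots> = (\<Lambda> * (3 * \<kappa> * q) powr p) * (h powr (- q) * w powr (q / 2))" by simp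
    also have "\<dots> \<le> \<kappa> * (h powr (- q) * w powr (q / 2))"
      using \<kappa> by (intro mult_right_mono) auto
    finally show ?thesis by (simp add: c_def w_def)
  qed
  moreover have "0 \<le> \<Lambda> * h * B * exp (B * (fst z - t))" using \<Lambda> h B by simp
  ultimately show False using \<Lambda> by (simp add: a_def)
qed

section \<open>Norms and the choice of constants\<close>

text \<open>By continuity the set where the bound fails is open; being null, it is empty.\<close>

lemma Linf_norm_imp_pointwise_bound:
  fixes u :: "'a::euclidean_space \<Rightarrow> real"
  assumes \<Omega>: "open \<Omega>" and cont: "continuous_on \<Omega> u" and norm: "Linf_norm \<Omega> u = ereal M"
    and z: "z \<in> \<Omega>"
  shows "\<bar>u z\<bar> \<le> M"
proof -
  define N where "N = {z \<in> \<Omega>. M < \<bar>u z\<bar>}"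
  have "AE w in lebesgue_on \<Omega>. ereal \<bar>u w\<bar> \<le> ereal M"
    using esssup_AE[of "\<lambda>z. ereal \<bar>u z\<bar>" "lebesgue_on \<Omega>"] norm by (simp add: Linf_norm_def)
  then have "AE w in lebesgue. w \<in> \<Omega> \<longrightarrow> \<bar>u w\<bar> \<le> M"
    using \<Omega> by (subst (asm) AE_restrict_space_iff) auto
  then have "AE w in lebesgue. w \<notin> N"
    by eventually_elim (auto simp: N_def)
  moreover have "open N"
  proof -
    have "N = \<Omega> \<inter> (\<lambda>z. \<bar>u z\<bar>) -` {M<..}" by (auto simp: N_def)
    moreover have "open (\<Omega> \<inter> (\<lambda>z. \<bar>u z\<bar>) -` {M<..})"
      using \<Omega> cont by (intro continuous_open_preimage continuous_intros) auto
    ultimately show ?thesis by simp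
  qed
  ultimately have "negligible N"
    using AE_iff_null_sets[of N lebesgue] by (simp add: negligible_iff_null_sets)
  then have "N = {}" using open_not_negligible \<open>open N\<close> by blast
  then show ?thesis using z by (auto simp: N_def not_less)
qed

lemma holder_normI:
  assumes bdd: "\<And>z. z \<in> S \<Longrightarrow> \<bar>u z\<bar> \<le> M"
    and holder: "\<And>z w. z \<in> S \<Longrightarrow> w \<in> S \<Longrightarrow> \<bar>u z - u w\<bar> \<le> L * dist z w powr \<alpha>"
    and S: "a \<in> S" "b \<in> S" "a \<noteq> b"
  shows "u \<in> holder_space \<alpha> S" "holder_norm \<alpha> S u \<le> M + L"
proof -
  show "u \<in> holder_space \<alpha> S"
    using bdd holder by (auto simp: holder_space_def bounded_iff)
  have "(SUP z\<in>S. \<bar>u z\<bar>) \<le> M" using bdd S by (intro cSUP_least) auto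
  moreover have "(SUP (z, w)\<in>{(z, w). z \<in> S \<and> w \<in> S \<and> z \<noteq> w}. \<bar>u z - u w\<bar> / dist z w powr \<alpha>) \<le> L"
    using holder S by (intro cSUP_least) (auto simp: pos_divide_le_eq)
  ultimately show "holder_norm \<alpha> S u \<le> M + L" by (simp add: holder_norm_def)
qed

theorem theorem1:
  fixes p \<Lambda> \<delta> M :: real
  assumes "1 < p" and "p < real CARD('n::finite)" and "\<Lambda> \<ge> 1" and "\<delta> > 0"
  shows "\<exists>\<alpha> C. 0 < \<alpha> \<and> \<alpha> < 1 \<and>
    (\<forall>(T::real) (H :: real \<Rightarrow> real ^ 'n \<Rightarrow> real ^ 'n \<Rightarrow> real) (u :: real \<times> (real ^ 'n) \<Rightarrow> real).
       \<delta> < T \<longrightarrow>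
       (\<forall>t x P. 0 < t \<and> t < T \<longrightarrow>
          1 / \<Lambda> * norm P powr p - \<Lambda> \<le> H t x P \<and> H t x P \<le> \<Lambda> * norm P powr p + \<Lambda>) \<longrightarrow>
       viscosity_solution ({0<..<T} \<times> UNIV) H u \<longrightarrow>
       bounded (u ` ({0<..<T} \<times> UNIV)) \<longrightarrow>
       Linf_norm ({0<..<T} \<times> UNIV) u = ereal M \<longrightarrow>
       u \<in> holder_space \<alpha> ({\<delta>..<T} \<times> UNIV) \<and>
       holder_norm \<alpha> ({\<delta>..<T} \<times> UNIV) u \<le> C)"
proof -
  define q where "q = p / (p - 1)"
  have q: "1 < q" using assms by (simp add: q_def field_simps)
  \<comment> \<open>This solves \<open>\<Lambda> * (3 * \<kappa> * q) powr p = \<kappa>\<close>, as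
    \<open>q - 1 = 1 / (p - 1)\<close>.\<close>
  define \<kappa> where "\<kappa> = (\<Lambda> * (3 * q) powr p) powr (1 - q)"
  have base: "1 \<le> \<Lambda> * (3 * q) powr p"
    using assms q mult_mono[of 1 \<Lambda> 1 "(3 * q) powr p"] by (simp add: ge_one_powr_ge_zero)
  have \<kappa>: "0 < \<kappa>" "\<kappa> \<le> 1"
    using base assms q powr_mono[of "1 - q" 0 "\<Lambda> * (3 * q) powr p"]
    by (auto simp: \<kappa>_def)
  have \<kappa>p: "\<Lambda> * (3 * \<kappa> * q) powr p \<le> \<kappa>"
  proof -
    define b where "b = \<Lambda> * (3 * q) powr p"
    have "\<Lambda> * (3 * \<kappa> * q) powr p = b * \<kappa> powr p"
      using powr_mult[of "3 * q" \<kappa> p] q \<kappa> by (simp add: b_def ac_simps)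
    also have "\<dots> = b powr (1 + (1 - q) * p)"
      using base by (simp add: \<kappa>_def b_def powr_powr powr_add)
    also have "1 + (1 - q) * p = 1 - q" using assms by (simp add: q_def field_simps)
    finally show ?thesis by (simp add: \<kappa>_def b_def)
  qed
  define C where "C = \<Lambda> powr (q - 1)"
  have C: "1 \<le> C" using assms q by (simp add: C_def ge_one_powr_ge_zero)
  \<comment> \<open>The constants are fixed before any \<open>u\<close> is given, so the sign of
    \<open>M\<close> is not yet known; hence \<open>max 0 M\<close>.\<close>
  have D: "0 \<le> 5 * \<Lambda>" and M0: "0 \<le> max 0 M" using assms by auto
  obtain \<alpha> L where \<alpha>: "0 < \<alpha>" "\<alpha> < 1"
    and L: "\<And>T (u :: real \<times> (real ^ 'n) \<Rightarrow> real) z w. action_bounds u T q C \<kappa> (5 * \<Lambda>) (max 0 M) \<Longrightarrow>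
      z \<in> {\<delta>..<T} \<times> UNIV \<Longrightarrow> w \<in> {\<delta>..<T} \<times> UNIV \<Longrightarrow> \<bar>u z - u w\<bar> \<le> L * dist z w powr \<alpha>"
    using action_bounds_imp_holder[OF q C \<kappa> D M0 assms(4), where 'a = "real ^ 'n"] by blast
  have "u \<in> holder_space \<alpha> ({\<delta>..<T} \<times> UNIV) \<and> holder_norm \<alpha> ({\<delta>..<T} \<times> UNIV) u \<le> max 0 M + L"
    if T: "\<delta> < T"
      and H: "\<forall>t x P. 0 < t \<and> t < T \<longrightarrow>
          1 / \<Lambda> * norm P powr p - \<Lambda> \<le> H t x P \<and> H t x P \<le> \<Lambda> * norm P powr p + \<Lambda>"
      and sol: "viscosity_solution ({0<..<T} \<times> UNIV) H u"
      and norm: "Linf_norm ({0<..<T} \<times> UNIV) u = ereal M"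
    for T H and u :: "real \<times> (real ^ 'n) \<Rightarrow> real"
  proof -
    have sub: "viscosity_subsolution ({0<..<T} \<times> UNIV) H u"
      and super: "viscosity_supersolution ({0<..<T} \<times> UNIV) H u"
      using sol by (auto simp: viscosity_solution_def)
    have bdd: "\<bar>u (t, x)\<bar> \<le> max 0 M" if "0 < t" "t < T" for t x
    proof -
      have "\<bar>u (t, x)\<bar> \<le> M"
        using sub norm that by (intro Linf_norm_imp_pointwise_bound[of "{0<..<T} \<times> UNIV"])
          (auto simp: viscosity_subsolution_def open_Times)
      then show ?thesis by simp
    qed
    have "action_bounds u T q C \<kappa> (5 * \<Lambda>) (max 0 M)"
    proof
      fix s t x y assume st: "0 < s" "s < t" "t < T"
      have "u (t, x) \<le> u (s, y) + C * cost q (dist x y) (t - s) + 2 * \<Lambda> * (t - s)"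
        unfolding C_def using H assms st
        by (intro subsolution_upper_bound[OF sub _ bdd _ q_def]) auto
      moreover have "2 * \<Lambda> * (t - s) \<le> 5 * \<Lambda> * (t - s)"
        using assms st by (intro mult_right_mono) auto
      ultimately show "u (t, x) \<le> u (s, y) + C * cost q (dist x y) (t - s) + 5 * \<Lambda> * (t - s)"
        by linarith
    next
      fix s t x assume st: "0 < s" "s < t" "t < T"
      show "\<exists>y. u (s, y) + \<kappa> * cost q (dist x y) (t - s) - 5 * \<Lambda> * (t - s) \<le> u (t, x)"
        using H assms st by (intro supersolution_lower_bound[OF super _ bdd _ q_def _ \<kappa> \<kappa>p]) auto
    qed (use q C \<kappa> assms bdd in auto)
    note L = L[OF this]
    \<comment> \<open>Two distinct points make the supremum of difference quotients range over a
      nonempty set.\<close>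
    define a b :: "real \<times> (real ^ 'n)" where "a = (\<delta>, 0)" and "b = ((\<delta> + T) / 2, 0)"
    have "a \<in> {\<delta>..<T} \<times> UNIV" "b \<in> {\<delta>..<T} \<times> UNIV" "a \<noteq> b"
      using T by (auto simp: a_def b_def)
    then show ?thesis
      using holder_normI[of "{\<delta>..<T} \<times> UNIV" u "max 0 M" L \<alpha> a b] bdd L assms by auto
  qed
  then show ?thesis using \<alpha> by blast
qed

end
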